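(* For each $n$, let $p=p(n)\le\frac12$ and let $M$ be an $n\times n$ random binary matrix with i.i.d. entries $m_{ij}$ with $\mathbb{P}(m_{ij}=1)=p$ and $\mathbb{P}(m_{ij}=0)=1-p$. Then, for any $\epsilon>0$, if $p\ge\frac{2(1+\epsilon)\log(n)}{n}$, then $$\mathbb{P}(M\text{ is reconstructible})\to 1\quad\text{as }n\to\infty.$$
   Context: For an $n\times n$ binary matrix $M$, let $\gamma_1,\dots,\gamma_n$ and $\rho_1,\dots,\rho_n$ be the multisets of columns and of rows of $M$, each listed in some arbitrary order (not necessarily the original one). $M$ is (uniquely) reconstructible if there is exactly one pair $(\sigma,\tau)$ of permutations of $\{1,\dots,n\}$ such that the matrix whose $i$-th row is $\rho_{\sigma_i}$ (for all $i$) equals the matrix whose $j$-th column is $\gamma_{\tau_j}$ (for all $j$). (At least one such pair always exists, coming from the original ordering; in particular a matrix with two equal rows or two equal columns is not reconstructible.) *)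

theory Defs
  imports
    "HOL-Probability.Probability"
    "HOL-Combinatorics.Permutations"
    "Jordan_Normal_Form.Matrix"
begin

definition reconstructions :: "'a vec list \<Rightarrow> 'a vec list \<Rightarrow> ((nat \<Rightarrow> nat) \<times> (nat \<Rightarrow> nat)) set" where
  "reconstructions \<rho> \<gamma> =
    {(\<sigma>, \<tau>). \<sigma> permutes {..<length \<rho>} \<and> \<tau> permutes {..<length \<gamma>} \<and>
       mat_of_rows (length \<gamma>) (permute_list \<sigma> \<rho>) = mat_of_cols (length \<rho>) (permute_list \<tau> \<gamma>)}"

text \<open>
  \<^term>\<open>\<rho>\<close> and \<^term>\<open>\<gamma>\<close> range over all orderings of the rows and of the columns.
  The number of reconstructions does not depend on the chosen orderings, so requiring
  uniqueness for all of them is the same as requiring it for one arbitrary choice.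
\<close>

definition reconstructible :: "'a mat \<Rightarrow> bool" where
  "reconstructible A \<longleftrightarrow>
    (\<forall>\<rho> \<gamma>. mset \<rho> = mset (Matrix.rows A) \<longrightarrow> mset \<gamma> = mset (Matrix.cols A) \<longrightarrow>
       card (reconstructions \<rho> \<gamma>) = 1)"

end

theory Submission
  imports Defs "HOL-Combinatorics.Cycles" "HOL-Real_Asymp.Real_Asymp"
begin

text \<open>
  List the rows and the columns of \<^term>\<open>A\<close> in any order.  Two different ways of putting them
  together differ by an automorphism of \<^term>\<open>A\<close>, that is, by a pair \<open>(\<alpha>, \<beta>)\<close> of permutations
  of the row and column indices with \<open>A(\<alpha> i, \<beta> j) = A(i, j)\<close> for all cells.  So
  \<^term>\<open>A\<close> is reconstructible iff its only automorphism is \<open>(id, id)\<close>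
  (\<open>reconstructible_iff_no_automorphism\<close>), and the theorem is a union bound over the nontrivial
  pairs.

  For a fixed pair, invariance forces the entries to agree along each cycle of the induced
  permutation of the cells.  A cycle of length \<open>c \<ge> 2\<close> is constant with probability
  \<open>p\<^sup>c + q\<^sup>c\<close>, where \<open>q = 1 - p\<close>, and this is at most \<open>(p\<^sup>2 + q\<^sup>2)\<close> to the power \<open>c / 2\<close>.
  Different cycles are independent, so invariance has probability at most \<open>exp(- p q N)\<close>, where
  \<open>N\<close> is the number of moved cells (\<open>prob_invariant_le\<close>).

  If \<open>\<alpha>\<close> moves \<open>k\<close> rows and \<open>\<beta>\<close> moves \<open>l\<close> columns, then \<open>N \<ge> n max(k, l) \<ge> n (k + l) / 2\<close>.
  With \<open>x = exp(- p q n / 2)\<close> the pair is thus an automorphism with probability at most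
  \<open>x\<^sup>k x\<^sup>l\<close>.  At most \<open>n\<^sup>k\<close> permutations move exactly \<open>k\<close> points, so the sum over all
  pairs is at most the square of the geometric series in \<open>n x\<close>, and removing the term 1 of the
  identity pair bounds the probability of failure by \<open>(1 / (1 - n x))\<^sup>2 - 1\<close>.

  For \<open>p \<ge> 2 (1 + \<epsilon>) ln n / n\<close> the number \<open>n x\<close> is about \<open>n\<close> to the power \<open>- \<epsilon>\<close> or smaller and
  tends to 0.  The factor 2 in the threshold pays for the loss of a factor 2 in
  \<open>N \<ge> n (k + l) / 2\<close>.
\<close>

section \<open>Reconstructibility as absence of automorphisms\<close>

lemma mat_of_rows_permuted_eq_mat_of_cols_permuted_iff:
  assumes A: "A \<in> carrier_mat m n" and \<alpha>: "\<alpha> permutes {..<m}" and \<beta>: "\<beta> permutes {..<n}"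
  shows "mat_of_rows n (permute_list \<alpha> (Matrix.rows A)) = mat_of_cols m (permute_list \<beta> (Matrix.cols A))
    \<longleftrightarrow> (\<forall>i<m. \<forall>j<n. A $$ (\<alpha> i, j) = A $$ (i, \<beta> j))"
proof -
  have [simp]: "dim_row A = m" "dim_col A = n" using A by auto
  have "\<alpha> i < m" if "i < m" for i using permutes_in_image[OF \<alpha>, of i] that by simp
  moreover have "\<beta> j < n" if "j < n" for j using permutes_in_image[OF \<beta>, of j] that by simp
  ultimately show ?thesis
    using \<alpha> \<beta> by (auto simp: mat_eq_iff mat_of_rows_def mat_of_cols_def permute_list_nth)
qed

definition automorphism :: "'a mat \<Rightarrow> (nat \<Rightarrow> nat) \<Rightarrow> (nat \<Rightarrow> nat) \<Rightarrow> bool" where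
  "automorphism A \<alpha> \<beta> \<longleftrightarrow> (\<forall>i<dim_row A. \<forall>j<dim_col A. A $$ (\<alpha> i, \<beta> j) = A $$ (i, j))"

text \<open>
  An assembly \<open>(\<sigma>, \<tau>)\<close> of the shuffled lists equates \<open>A(a (\<sigma> i), j)\<close> with \<open>A(i, b (\<tau> j))\<close>.
  Moving the column permutation to the other side is what makes its inverse appear.
\<close>

lemma reconstructions_permuted:
  assumes A: "A \<in> carrier_mat m n" and a: "a permutes {..<m}" and b: "b permutes {..<n}"
  shows "reconstructions (permute_list a (Matrix.rows A)) (permute_list b (Matrix.cols A))
    = {(\<sigma>, \<tau>). \<sigma> permutes {..<m} \<and> \<tau> permutes {..<n} \<and> automorphism A (a \<circ> \<sigma>) (Hilbert_Choice.inv (b \<circ> \<tau>))}"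
proof -
  have [simp]: "dim_row A = m" "dim_col A = n" using A by auto
  have "mat_of_rows n (permute_list \<sigma> (permute_list a (Matrix.rows A)))
        = mat_of_cols m (permute_list \<tau> (permute_list b (Matrix.cols A)))
      \<longleftrightarrow> automorphism A (a \<circ> \<sigma>) (Hilbert_Choice.inv (b \<circ> \<tau>))"
    if \<sigma>: "\<sigma> permutes {..<m}" and \<tau>: "\<tau> permutes {..<n}" for \<sigma> \<tau>
  proof -
    let ?\<beta> = "b \<circ> \<tau>"
    have \<beta>: "?\<beta> permutes {..<n}" using permutes_compose[OF \<tau> b] .
    have "(\<forall>j<n. A $$ ((a \<circ> \<sigma>) i, j) = A $$ (i, ?\<beta> j))
        \<longleftrightarrow> (\<forall>j<n. A $$ ((a \<circ> \<sigma>) i, Hilbert_Choice.inv ?\<beta> j) = A $$ (i, j))" for i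
      using permutes_in_image[OF \<beta>] permutes_in_image[OF permutes_inv[OF \<beta>]]
        permutes_inverses[OF \<beta>] by (metis lessThan_iff)
    then show ?thesis
      using mat_of_rows_permuted_eq_mat_of_cols_permuted_iff[OF A permutes_compose[OF \<sigma> a] \<beta>] \<sigma> \<tau>
      by (simp add: permute_list_compose automorphism_def)
  qed
  then show ?thesis by (auto simp: reconstructions_def)
qed

text \<open>
  For the original order of the lists, the identity pair is one assembly, and any automorphism
  gives another.  For an arbitrary order, given by \<open>a\<close> and \<open>b\<close>, the assembly that undoes the
  shuffling is the only one that corresponds to the trivial automorphism.
\<close>

lemma reconstructible_iff_no_automorphism:
  assumes A: "A \<in> carrier_mat m n"
  shows "reconstructible A \<longleftrightarrow>
    (\<forall>\<alpha> \<beta>. \<alpha> permutes {..<m} \<longrightarrow> \<beta> permutes {..<n} \<longrightarrow> automorphism A \<alpha> \<beta> \<longrightarrow> \<alpha> = id \<and> \<beta> = id)"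
    (is "?L \<longleftrightarrow> ?R")
proof
  assume ?L
  then have "card (reconstructions (permute_list id (Matrix.rows A)) (permute_list id (Matrix.cols A))) = 1"
    by (simp add: reconstructible_def)
  then obtain z where
    z: "{(\<sigma>, \<tau>). \<sigma> permutes {..<m} \<and> \<tau> permutes {..<n} \<and> automorphism A \<sigma> (Hilbert_Choice.inv \<tau>)} = {z}"
    unfolding reconstructions_permuted[OF A permutes_id permutes_id]
    by (auto simp: card_1_singleton_iff)
  show ?R
  proof (intro allI impI)
    fix \<alpha> \<beta> assume *: "\<alpha> permutes {..<m}" "\<beta> permutes {..<n}" "automorphism A \<alpha> \<beta>"
    have "(\<alpha>, Hilbert_Choice.inv \<beta>) \<in> {z}" "(id, id) \<in> {z}"
      unfolding z[symmetric] using * permutes_inv[OF *(2)]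
      by (auto simp: permutes_inv_inv permutes_id automorphism_def)
    then have "\<alpha> = id" "Hilbert_Choice.inv \<beta> = id" by auto
    then show "\<alpha> = id \<and> \<beta> = id" using permutes_inv_inv[OF *(2)] by auto
  qed
next
  have dims: "length (Matrix.rows A) = m" "length (Matrix.cols A) = n" using A by auto
  assume R: ?R
  show ?L
    unfolding reconstructible_def
  proof (intro allI impI)
    fix \<rho> \<gamma> assume "mset \<rho> = mset (Matrix.rows A)" "mset \<gamma> = mset (Matrix.cols A)"
    then obtain a b where a: "a permutes {..<m}" "permute_list a (Matrix.rows A) = \<rho>"
      and b: "b permutes {..<n}" "permute_list b (Matrix.cols A) = \<gamma>"
      by (metis mset_eq_permutation dims)
    have "reconstructions \<rho> \<gamma> = {(Hilbert_Choice.inv a, Hilbert_Choice.inv b)}"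
      unfolding a(2)[symmetric] b(2)[symmetric] reconstructions_permuted[OF A a(1) b(1)]
    proof (intro equalityI subsetI)
      fix z assume "z \<in> {(\<sigma>, \<tau>). \<sigma> permutes {..<m} \<and> \<tau> permutes {..<n}
        \<and> automorphism A (a \<circ> \<sigma>) (Hilbert_Choice.inv (b \<circ> \<tau>))}"
      then obtain \<sigma> \<tau> where z: "z = (\<sigma>, \<tau>)" and \<sigma>: "\<sigma> permutes {..<m}" and \<tau>: "\<tau> permutes {..<n}"
        and aut: "automorphism A (a \<circ> \<sigma>) (Hilbert_Choice.inv (b \<circ> \<tau>))" by auto
      have b\<tau>: "b \<circ> \<tau> permutes {..<n}" using permutes_compose[OF \<tau> b(1)] .
      have "a \<circ> \<sigma> = id" "Hilbert_Choice.inv (b \<circ> \<tau>) = id"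
        using R permutes_compose[OF \<sigma> a(1)] permutes_inv[OF b\<tau>] aut by blast+
      then have "a \<circ> \<sigma> = id" "b \<circ> \<tau> = id" using permutes_inv_inv[OF b\<tau>] by auto
      then have "\<sigma> = Hilbert_Choice.inv a" "\<tau> = Hilbert_Choice.inv b"
        using permutes_inv_o[OF a(1)] permutes_inv_o[OF b(1)]
        by (metis comp_assoc comp_id id_comp)+
      then show "z \<in> {(Hilbert_Choice.inv a, Hilbert_Choice.inv b)}" using z by simp
    next
      fix z assume "z \<in> {(Hilbert_Choice.inv a, Hilbert_Choice.inv b)}"
      then show "z \<in> {(\<sigma>, \<tau>). \<sigma> permutes {..<m} \<and> \<tau> permutes {..<n}
        \<and> automorphism A (a \<circ> \<sigma>) (Hilbert_Choice.inv (b \<circ> \<tau>))}"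
        using permutes_inv[OF a(1)] permutes_inv[OF b(1)] permutes_inv_o[OF b(1)]
        by (simp add: automorphism_def permutes_inverses[OF a(1)])
    qed
    then show "card (reconstructions \<rho> \<gamma>) = 1" by simp
  qed
qed

section \<open>Invariance of independent bits under a permutation\<close>

text \<open>
  Both \<^term>\<open>p\<close> and \<^term>\<open>q\<close> are bounded by the root, so all but two factors of each power may be
  replaced by it.
\<close>

lemma power_sum_le_sqrt_power:
  fixes p q :: real
  assumes "0 \<le> p" "0 \<le> q" "2 \<le> c"
  shows "p ^ c + q ^ c \<le> sqrt (p\<^sup>2 + q\<^sup>2) ^ c"
proof -
  define R where "R = sqrt (p\<^sup>2 + q\<^sup>2)"
  obtain d where c: "c = d + 2" using assms(3) by (metis add.commute le_Suc_ex)
  have R: "0 \<le> R" "R\<^sup>2 = p\<^sup>2 + q\<^sup>2" by (simp_all add: R_def)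
  have "p \<le> R" "q \<le> R"
    using R(1) by (simp_all add: R_def real_le_rsqrt)
  then have "p ^ d * p\<^sup>2 + q ^ d * q\<^sup>2 \<le> R ^ d * p\<^sup>2 + R ^ d * q\<^sup>2"
    using assms by (intro add_mono mult_right_mono power_mono) auto
  also have "\<dots> = R ^ c" unfolding c power_add R(2) by (rule distrib_left[symmetric])
  finally show ?thesis by (simp only: R_def c power_add)
qed

lemma rotate1_eq_imp_all_equal:
  assumes "rotate1 xs = xs" "y \<in> set xs"
  shows "y = hd xs"
proof -
  have "xs ! k = xs ! 0" if "k < length xs" for k
    using that
  proof (induction k)
    case (Suc k)
    then show ?case
      using nth_rotate1[of k xs] assms(1) by (simp add: mod_less)
  qed simp
  then show ?thesis
    using assms(2) by (metis hd_conv_nth in_set_conv_nth length_pos_if_in_set length_greater_0_conv)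
qed

lemma cycle_decomp_imp_permutes: "cycle_decomp I \<pi> \<Longrightarrow> \<pi> permutes I"
proof (induction rule: cycle_decomp.induct)
  case (comp I \<pi> cs)
  then show ?case
    using permutes_compose[OF permutes_subset[OF comp.IH] permutes_subset[OF cycle_permutes[of cs]]] by blast
qed (rule permutes_id)

lemma invariant_under_cycle_imp_constant:
  assumes "cycle cs" "\<And>a. a \<in> set cs \<Longrightarrow> f (cycle_of_list cs a) = f a" "a \<in> set cs" "b \<in> set cs"
  shows "f a = f b"
proof -
  have "rotate1 (map f cs) = map f (map (cycle_of_list cs) cs)"
    using cyclic_rotation[OF assms(1), of 1] by (simp add: rotate1_map)
  also have "\<dots> = map f cs" using assms(2) by simp
  finally show ?thesis
    using rotate1_eq_imp_all_equal[of "map f cs"] assms(3,4) by (metis image_eqI list.set_map)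
qed

context prob_space
begin

context
  fixes X :: "'i \<Rightarrow> 'a \<Rightarrow> bool" and I :: "'i set" and p :: real
  assumes indep: "indep_vars (\<lambda>_. count_space UNIV) X I"
    and finI: "finite I"
    and p01: "0 \<le> p" "p \<le> 1"
    and dist: "\<And>i b. i \<in> I \<Longrightarrow> prob {\<omega> \<in> space M. X i \<omega> = b} = (if b then p else 1 - p)"
begin

lemma bit_measurable [measurable]: "i \<in> I \<Longrightarrow> X i \<in> measurable M (count_space UNIV)"
  using indep by (simp add: indep_vars_def)

lemma prob_constant_on:
  assumes C: "C \<subseteq> I" "C \<noteq> {}"
  shows "prob {\<omega> \<in> space M. \<forall>a\<in>C. \<forall>b\<in>C. X a \<omega> = X b \<omega>} = p ^ card C + (1 - p) ^ card C"
proof -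
  have finC: "finite C" using C finI finite_subset by blast
  let ?E = "\<lambda>v. {\<omega> \<in> space M. \<forall>a\<in>C. X a \<omega> = v}"
  have E: "?E v = (\<Inter>a\<in>C. X a -` {v} \<inter> space M)" for v using C by auto
  have ms: "?E v \<in> events" for v
    unfolding E using C finC by (intro sets.finite_INT) (auto intro!: measurable_sets[OF bit_measurable])
  have pr: "prob (?E v) = (if v then p else 1 - p) ^ card C" for v
  proof -
    have "prob (?E v) = (\<Prod>a\<in>C. prob (X a -` {v} \<inter> space M))"
      unfolding E using C finC by (intro indep_varsD[OF indep]) auto
    also have "\<dots> = (\<Prod>a\<in>C. if v then p else 1 - p)"
    proof (intro prod.cong refl)
      fix a assume "a \<in> C"
      then have "prob {\<omega> \<in> space M. X a \<omega> = v} = (if v then p else 1 - p)" using dist C by blast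
      then show "prob (X a -` {v} \<inter> space M) = (if v then p else 1 - p)"
        by (simp add: vimage_def Int_def conj_commute)
    qed
    finally show ?thesis by simp
  qed
  have "{\<omega> \<in> space M. \<forall>a\<in>C. \<forall>b\<in>C. X a \<omega> = X b \<omega>} = ?E True \<union> ?E False" by blast
  moreover have "?E True \<inter> ?E False = {}" using C by auto
  ultimately show ?thesis using finite_measure_Union[OF ms ms, of True False] pr[of True] pr[of False] by simp
qed

text \<open>
  Events that depend on disjoint sets of bits are independent.  The events are predicates on the
  restricted families, because these are the random variables whose independence is known.
\<close>

lemma prob_independent_blocks:
  assumes "C \<inter> J = {}" "C \<subseteq> I" "J \<subseteq> I"
    and P: "Measurable.pred (PiM C (\<lambda>_. count_space UNIV)) P"
    and Q: "Measurable.pred (PiM J (\<lambda>_. count_space UNIV)) Q"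
  shows "prob {\<omega> \<in> space M. P (\<lambda>i\<in>C. X i \<omega>) \<and> Q (\<lambda>i\<in>J. X i \<omega>)}
    = prob {\<omega> \<in> space M. P (\<lambda>i\<in>C. X i \<omega>)} * prob {\<omega> \<in> space M. Q (\<lambda>i\<in>J. X i \<omega>)}"
proof -
  let ?XP = "{f \<in> space (PiM C (\<lambda>_. count_space (UNIV::bool set))). P f}"
  let ?XQ = "{f \<in> space (PiM J (\<lambda>_. count_space (UNIV::bool set))). Q f}"
  have sp: "(\<lambda>i\<in>K. X i \<omega>) \<in> space (PiM K (\<lambda>_. count_space (UNIV::bool set)))" for K \<omega>
    by (simp add: space_PiM)
  have "prob ((\<lambda>\<omega>. (\<lambda>i\<in>C. X i \<omega>, \<lambda>i\<in>J. X i \<omega>)) -` (?XP \<times> ?XQ) \<inter> space M)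
      = prob ((\<lambda>\<omega>. \<lambda>i\<in>C. X i \<omega>) -` ?XP \<inter> space M) * prob ((\<lambda>\<omega>. \<lambda>i\<in>J. X i \<omega>) -` ?XQ \<inter> space M)"
    using P Q by (intro indep_varD[OF indep_var_restrict[OF indep]]) (use assms in auto)
  moreover have "(\<lambda>\<omega>. (\<lambda>i\<in>C. X i \<omega>, \<lambda>i\<in>J. X i \<omega>)) -` (?XP \<times> ?XQ) \<inter> space M
      = {\<omega> \<in> space M. P (\<lambda>i\<in>C. X i \<omega>) \<and> Q (\<lambda>i\<in>J. X i \<omega>)}"
    using sp by auto
  moreover have "(\<lambda>\<omega>. \<lambda>i\<in>C. X i \<omega>) -` ?XP \<inter> space M = {\<omega> \<in> space M. P (\<lambda>i\<in>C. X i \<omega>)}"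
    using sp by auto
  moreover have "(\<lambda>\<omega>. \<lambda>i\<in>J. X i \<omega>) -` ?XQ \<inter> space M = {\<omega> \<in> space M. Q (\<lambda>i\<in>J. X i \<omega>)}"
    using sp by auto
  ultimately show ?thesis by simp
qed

text \<open>
  Induction over the cycles.  A new cycle \<open>cs\<close> is disjoint from the cells treated before, so
  invariance of the bits on it, which means that they are all equal, is an independent event.  A
  cycle of length 1 contributes the factor 1 and no moved point; for this reason the exponent
  counts moved points only.
\<close>

lemma prob_invariant_cycle_decomp:
  assumes "cycle_decomp J \<pi>" "J \<subseteq> I"
  shows "prob {\<omega> \<in> space M. \<forall>a\<in>J. X (\<pi> a) \<omega> = X a \<omega>}
    \<le> sqrt (p\<^sup>2 + (1 - p)\<^sup>2) ^ card {a \<in> J. \<pi> a \<noteq> a}"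
  using assms
proof (induction rule: cycle_decomp.induct)
  case empty
  then show ?case by (simp add: prob_space)
next
  case (comp J \<pi> cs)
  let ?R = "sqrt (p\<^sup>2 + (1 - p)\<^sup>2)"
  let ?C = "set cs" and ?\<kappa> = "cycle_of_list cs"
  have J: "J \<subseteq> I" and C: "?C \<subseteq> I" and finJ: "finite J" using comp.prems finI finite_subset by auto
  have \<pi>: "\<pi> permutes J" using comp.hyps(1) by (rule cycle_decomp_imp_permutes)
  have onJ: "\<pi> a \<in> J" "(?\<kappa> \<circ> \<pi>) a = \<pi> a" if "a \<in> J" for a
  proof -
    show "\<pi> a \<in> J" using that permutes_in_image[OF \<pi>] by simp
    then show "(?\<kappa> \<circ> \<pi>) a = \<pi> a" using comp.hyps(3) by (auto intro!: id_outside_supp)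
  qed
  have onC: "(?\<kappa> \<circ> \<pi>) a = ?\<kappa> a" if "a \<in> ?C" for a
  proof -
    have "a \<notin> J" using that comp.hyps(3) by blast
    then show ?thesis using permutes_not_in[OF \<pi>] by simp
  qed
  let ?P = "\<lambda>f :: 'i \<Rightarrow> bool. \<forall>a\<in>?C. \<forall>b\<in>?C. f a = f b"
  let ?Q = "\<lambda>f :: 'i \<Rightarrow> bool. \<forall>a\<in>J. f (\<pi> a) = f a"
  let ?EC = "{\<omega> \<in> space M. \<forall>a\<in>?C. \<forall>b\<in>?C. X a \<omega> = X b \<omega>}"
  let ?EJ = "{\<omega> \<in> space M. \<forall>a\<in>J. X (\<pi> a) \<omega> = X a \<omega>}"
  have E: "{\<omega> \<in> space M. \<forall>a\<in>?C \<union> J. X ((?\<kappa> \<circ> \<pi>) a) \<omega> = X a \<omega>}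
      \<subseteq> {\<omega> \<in> space M. ?P (\<lambda>i\<in>?C. X i \<omega>) \<and> ?Q (\<lambda>i\<in>J. X i \<omega>)}"
  proof (intro subsetI CollectI conjI)
    fix \<omega> assume \<omega>: "\<omega> \<in> {\<omega> \<in> space M. \<forall>a\<in>?C \<union> J. X ((?\<kappa> \<circ> \<pi>) a) \<omega> = X a \<omega>}"
    show "\<omega> \<in> space M" using \<omega> by simp
    have "X (?\<kappa> a) \<omega> = X a \<omega>" if "a \<in> ?C" for a using \<omega> onC that by (metis (mono_tags, lifting) UnCI mem_Collect_eq)
    then have "X a \<omega> = X b \<omega>" if "a \<in> ?C" "b \<in> ?C" for a b
      using invariant_under_cycle_imp_constant[OF comp.hyps(2), of "\<lambda>a. X a \<omega>"] that by blast
    then show "?P (\<lambda>i\<in>?C. X i \<omega>)" unfolding restrict_def by (metis (full_types))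
    have "X (\<pi> a) \<omega> = X a \<omega>" if "a \<in> J" for a
      using \<omega> onJ(2) that by (metis (mono_tags, lifting) UnCI mem_Collect_eq)
    then show "?Q (\<lambda>i\<in>J. X i \<omega>)" using onJ(1) by simp
  qed
  have R0: "0 \<le> ?R" by simp
  have C_bound: "prob ?EC \<le> ?R ^ (if length cs \<ge> 2 then length cs else 0)"
  proof (cases "length cs \<ge> 2")
    case True
    then have "?C \<noteq> {}" by auto
    then have "prob ?EC = p ^ length cs + (1 - p) ^ length cs"
      using prob_constant_on[OF C] distinct_card[OF comp.hyps(2)] by simp
    then show ?thesis using True power_sum_le_sqrt_power[of p "1 - p" "length cs"] p01 by simp
  qed simp
  have moved: "card {a \<in> ?C \<union> J. (?\<kappa> \<circ> \<pi>) a \<noteq> a}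
      = (if length cs \<ge> 2 then length cs else 0) + card {a \<in> J. \<pi> a \<noteq> a}"
  proof -
    have C_moved: "card {a \<in> ?C. ?\<kappa> a \<noteq> a} = (if length cs \<ge> 2 then length cs else 0)"
    proof (cases "length cs \<ge> 2")
      case True
      have "?\<kappa> a \<noteq> a" if "a \<in> ?C" for a
      proof -
        obtain k where k: "k < length cs" "a = cs ! k" using \<open>a \<in> ?C\<close> by (auto simp: in_set_conv_nth)
        have "map ?\<kappa> cs ! k = rotate1 cs ! k" using cyclic_rotation[OF comp.hyps(2), of 1] by simp
        then have "?\<kappa> a = cs ! (Suc k mod length cs)" using k nth_rotate1[OF k(1)] by simp
        moreover have "Suc k mod length cs \<noteq> k"
          using True k(1) by (cases "Suc k = length cs") auto
        ultimately show ?thesis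
          using k True comp.hyps(2) by (metis mod_less_divisor nth_eq_iff_index_eq order.strict_trans2 pos2)
      qed
      then have "{a \<in> ?C. ?\<kappa> a \<noteq> a} = ?C" by auto
      then show ?thesis using True distinct_card[OF comp.hyps(2)] by simp
    next
      case False
      then have "?\<kappa> = id" by (cases cs rule: cycle_of_list.cases) auto
      then show ?thesis using False by simp
    qed
    have "(?\<kappa> \<circ> \<pi>) a \<noteq> a \<longleftrightarrow> \<pi> a \<noteq> a" if "a \<in> J" for a by (simp only: onJ(2)[OF that])
    moreover have "(?\<kappa> \<circ> \<pi>) a \<noteq> a \<longleftrightarrow> ?\<kappa> a \<noteq> a" if "a \<in> ?C" for a by (simp only: onC[OF that])
    ultimately have "{a \<in> ?C \<union> J. (?\<kappa> \<circ> \<pi>) a \<noteq> a} = {a \<in> ?C. ?\<kappa> a \<noteq> a} \<union> {a \<in> J. \<pi> a \<noteq> a}"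
      by blast
    moreover have "{a \<in> ?C. ?\<kappa> a \<noteq> a} \<inter> {a \<in> J. \<pi> a \<noteq> a} = {}" using comp.hyps(3) by auto
    ultimately show ?thesis using C_moved card_Un_disjoint[of "{a \<in> ?C. ?\<kappa> a \<noteq> a}" "{a \<in> J. \<pi> a \<noteq> a}"] finJ by simp
  qed
  have Pm: "Measurable.pred (PiM ?C (\<lambda>_. count_space UNIV)) ?P" by measurable
  have Qm: "Measurable.pred (PiM J (\<lambda>_. count_space UNIV)) ?Q"
    using onJ(1) finJ by measurable
  have eqC: "{\<omega> \<in> space M. ?P (\<lambda>i\<in>?C. X i \<omega>)} = ?EC" by auto
  have eqJ: "{\<omega> \<in> space M. ?Q (\<lambda>i\<in>J. X i \<omega>)} = ?EJ" using onJ(1) by auto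
  have fact: "prob {\<omega> \<in> space M. ?P (\<lambda>i\<in>?C. X i \<omega>) \<and> ?Q (\<lambda>i\<in>J. X i \<omega>)} = prob ?EC * prob ?EJ"
    using prob_independent_blocks[OF comp.hyps(3) C J Pm Qm] unfolding eqC eqJ .
  have "{\<omega> \<in> space M. ?P (\<lambda>i\<in>?C. X i \<omega>) \<and> ?Q (\<lambda>i\<in>J. X i \<omega>)}
      = {\<omega> \<in> space M. ?P (\<lambda>i\<in>?C. X i \<omega>)} \<inter> {\<omega> \<in> space M. ?Q (\<lambda>i\<in>J. X i \<omega>)}" by auto
  moreover have "?EC \<in> events" 
  proof -
    have [measurable]: "X a \<in> measurable M (count_space UNIV)" if "a \<in> ?C" for a using that C by auto
    show ?thesis by measurable
  qed
  moreover have "?EJ \<in> events"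
  proof -
    have [measurable]: "X a \<in> measurable M (count_space UNIV)" "X (\<pi> a) \<in> measurable M (count_space UNIV)"
      if "a \<in> J" for a using that J onJ(1) by (blast intro: bit_measurable)+
    show ?thesis using finJ by measurable
  qed
  ultimately have "{\<omega> \<in> space M. ?P (\<lambda>i\<in>?C. X i \<omega>) \<and> ?Q (\<lambda>i\<in>J. X i \<omega>)} \<in> events"
    unfolding eqC eqJ by (metis (no_types, lifting) sets.Int)
  then have "prob {\<omega> \<in> space M. \<forall>a\<in>?C \<union> J. X ((?\<kappa> \<circ> \<pi>) a) \<omega> = X a \<omega>} \<le> prob ?EC * prob ?EJ"
    unfolding fact[symmetric] using E by (intro finite_measure_mono) auto
  also have "\<dots> \<le> ?R ^ (if length cs \<ge> 2 then length cs else 0) * ?R ^ card {a \<in> J. \<pi> a \<noteq> a}"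
    using C_bound comp.IH[OF J] R0 by (intro mult_mono) auto
  also have "\<dots> = ?R ^ card {a \<in> ?C \<union> J. (?\<kappa> \<circ> \<pi>) a \<noteq> a}"
    unfolding moved power_add ..
  finally show ?case .
qed

text \<open>
  The bound \<open>p\<^sup>2 + q\<^sup>2 = 1 - 2 p q \<le> exp(- 2 p q)\<close> turns the previous estimate into an
  exponential one.
\<close>

lemma prob_invariant_le:
  assumes \<pi>: "\<pi> permutes I"
  shows "prob {\<omega> \<in> space M. \<forall>a\<in>I. X (\<pi> a) \<omega> = X a \<omega>}
    \<le> exp (- (p * (1 - p))) ^ card {a \<in> I. \<pi> a \<noteq> a}"
proof -
  have "p\<^sup>2 + (1 - p)\<^sup>2 = 1 + - (2 * (p * (1 - p)))" by (simp add: power2_eq_square algebra_simps)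
  also have "\<dots> \<le> exp (- (2 * (p * (1 - p))))" by (rule exp_ge_add_one_self)
  also have "\<dots> = (exp (- (p * (1 - p))))\<^sup>2" by (simp add: power2_eq_square flip: exp_add)
  finally have "sqrt (p\<^sup>2 + (1 - p)\<^sup>2) \<le> exp (- (p * (1 - p)))" by (rule real_le_lsqrt[rotated]) simp
  then show ?thesis
    using prob_invariant_cycle_decomp[OF cycle_decomposition[OF \<pi> finI] order.refl]
    by (meson order.trans power_mono real_sqrt_ge_zero sum_power2_ge_zero)
qed

end

end

section \<open>Counting permutations by the number of moved points\<close>

text \<open>
  Such a permutation is determined by its support, a set of \<^term>\<open>k\<close> points, and its restriction to
  the support.
\<close>

lemma card_permutations_moving_le:
  assumes "finite S"
  shows "card {\<alpha>. \<alpha> permutes S \<and> card {i \<in> S. \<alpha> i \<noteq> i} = k} \<le> card S ^ k"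
proof -
  let ?T = "{T. T \<subseteq> S \<and> card T = k}"
  have "{\<alpha>. \<alpha> permutes S \<and> card {i \<in> S. \<alpha> i \<noteq> i} = k} \<subseteq> (\<Union>T\<in>?T. {\<alpha>. \<alpha> permutes T})"
  proof
    fix \<alpha> assume \<alpha>: "\<alpha> \<in> {\<alpha>. \<alpha> permutes S \<and> card {i \<in> S. \<alpha> i \<noteq> i} = k}"
    then have "\<alpha> permutes S" by blast
    then have "\<alpha> permutes {i \<in> S. \<alpha> i \<noteq> i}" by (rule permutes_superset) blast
    then show "\<alpha> \<in> (\<Union>T\<in>?T. {\<alpha>. \<alpha> permutes T})"
      using \<alpha> by (intro UN_I[of "{i \<in> S. \<alpha> i \<noteq> i}"]) simp_all
  qed
  moreover have finT: "finite ?T" using assms by simp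
  moreover have "finite {\<alpha>. \<alpha> permutes T}" if "T \<in> ?T" for T
    using that finite_subset[OF _ assms] by (intro finite_permutations) blast
  ultimately have "card {\<alpha>. \<alpha> permutes S \<and> card {i \<in> S. \<alpha> i \<noteq> i} = k} \<le> card (\<Union>T\<in>?T. {\<alpha>. \<alpha> permutes T})"
    by (intro card_mono) auto
  also have "\<dots> \<le> (\<Sum>T\<in>?T. card {\<alpha>. \<alpha> permutes T})" using finT by (rule card_UN_le)
  also have "\<dots> = (\<Sum>T\<in>?T. fact k)"
    using assms finite_subset by (intro sum.cong refl card_permutations) auto
  also have "\<dots> = (card S choose k) * fact k" using n_subsets[OF assms] by simp
  also have "\<dots> \<le> card S ^ k" by (rule binomial_fact_pow)
  finally show ?thesis .
qed

lemma sum_permutations_power_moved_le: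
  fixes x :: real
  assumes fin: "finite S" and x: "0 \<le> x" "card S * x < 1"
  shows "(\<Sum>\<alpha> | \<alpha> permutes S. x ^ card {i \<in> S. \<alpha> i \<noteq> i}) \<le> 1 / (1 - card S * x)"
proof -
  let ?P = "{\<alpha>. \<alpha> permutes S}" and ?m = "\<lambda>\<alpha>. card {i \<in> S. \<alpha> i \<noteq> i}" and ?N = "card S"
  have "(\<Sum>\<alpha>\<in>?P. x ^ ?m \<alpha>) = (\<Sum>k\<le>?N. \<Sum>\<alpha>\<in>{\<alpha> \<in> ?P. ?m \<alpha> = k}. x ^ ?m \<alpha>)"
    using fin by (intro sum.group[symmetric]) (auto intro!: finite_permutations card_mono)
  also have "\<dots> = (\<Sum>k\<le>?N. card {\<alpha> \<in> ?P. ?m \<alpha> = k} * x ^ k)" by simp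
  also have "\<dots> \<le> (\<Sum>k\<le>?N. (?N * x) ^ k)"
  proof (intro sum_mono)
    fix k
    have "real (card {\<alpha> \<in> ?P. ?m \<alpha> = k}) \<le> real (?N ^ k)"
      using card_permutations_moving_le[OF fin, of k] unfolding of_nat_le_iff by simp
    then show "card {\<alpha> \<in> ?P. ?m \<alpha> = k} * x ^ k \<le> (?N * x) ^ k"
      using x(1) by (simp add: power_mult_distrib mult_right_mono)
  qed
  also have "\<dots> \<le> (\<Sum>k. (?N * x) ^ k)"
    using x by (intro sum_le_suminf summable_geometric) auto
  also have "\<dots> = 1 / (1 - ?N * x)" using x by (intro suminf_geometric) simp
  finally show ?thesis .
qed

section \<open>The union bound\<close>

text \<open>
  All cells of a moved row are moved, and so are all cells of a moved column.  Hence each of the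
  two counts is at most the number of moved cells, which yields the factor 2.
\<close>

lemma moved_cells_ge:
  fixes \<alpha> :: "nat \<Rightarrow> nat" and \<beta> :: "nat \<Rightarrow> nat"
  shows "n * (card {i \<in> {..<n}. \<alpha> i \<noteq> i} + card {j \<in> {..<n}. \<beta> j \<noteq> j})
    \<le> 2 * card {c \<in> {..<n} \<times> {..<n}. map_prod \<alpha> \<beta> c \<noteq> c}" (is "_ \<le> 2 * card ?U")
proof -
  have "card ({i \<in> {..<n}. \<alpha> i \<noteq> i} \<times> {..<n}) \<le> card ?U" by (rule card_mono) auto
  moreover have "card ({..<n} \<times> {j \<in> {..<n}. \<beta> j \<noteq> j}) \<le> card ?U" by (rule card_mono) auto
  ultimately show ?thesis by (simp add: card_cartesian_product algebra_simps)
qed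

text \<open>
  The union bound.  The sum over all pairs factors into the square of a sum over single
  permutations, and the subtracted identity pair accounts for the constant 2 in place of 1.
\<close>

lemma (in prob_space) random_matrix_reconstructible_ge:
  fixes A :: "'a \<Rightarrow> bool mat" and p :: real
  assumes carrier: "\<And>\<omega>. \<omega> \<in> space M \<Longrightarrow> A \<omega> \<in> carrier_mat n n"
    and indep: "indep_vars (\<lambda>_. count_space UNIV) (\<lambda>(i, j) \<omega>. A \<omega> $$ (i, j)) ({..<n} \<times> {..<n})"
    and p01: "0 \<le> p" "p \<le> 1"
    and dist: "\<And>i j b. i < n \<Longrightarrow> j < n \<Longrightarrow>
      prob {\<omega> \<in> space M. A \<omega> $$ (i, j) = b} = (if b then p else 1 - p)"
    and x: "x = exp (- (p * (1 - p) * n / 2))" "n * x < 1"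
  shows "prob {\<omega> \<in> space M. reconstructible (A \<omega>)} \<ge> 2 - (1 / (1 - n * x))\<^sup>2"
proof -
  let ?I = "{..<n} \<times> {..<n}" and ?P = "{\<alpha>. \<alpha> permutes {..<n}}"
  let ?X = "\<lambda>(i, j) \<omega>. A \<omega> $$ (i, j)"
  let ?m = "\<lambda>\<alpha> :: nat \<Rightarrow> nat. card {i \<in> {..<n}. \<alpha> i \<noteq> i}"
  define F where "F z = {\<omega> \<in> space M. automorphism (A \<omega>) (fst z) (snd z)}" for z
  have dims: "dim_row (A \<omega>) = n" "dim_col (A \<omega>) = n" if "\<omega> \<in> space M" for \<omega>
    using carrier[OF that] by auto
  have less: "\<alpha> i < n" if "\<alpha> permutes {..<n}" "i < n" for \<alpha> i
    using permutes_in_image[OF that(1), of i] that(2) by simp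
  have entry: "(\<lambda>\<omega>. A \<omega> $$ (i, j)) \<in> measurable M (count_space UNIV)" if "i < n" "j < n" for i j
  proof -
    have "\<forall>c\<in>?I. ?X c \<in> measurable M (count_space UNIV)" using indep unfolding indep_vars_def by (rule conjunct1)
    then have "?X (i, j) \<in> measurable M (count_space UNIV)" using that by blast
    then show ?thesis by simp
  qed
  have F_event: "F z \<in> events" if z: "z \<in> ?P \<times> ?P" for z
  proof -
    have [measurable]: "(\<lambda>\<omega>. A \<omega> $$ (i, j)) \<in> measurable M (count_space UNIV)"
      "(\<lambda>\<omega>. A \<omega> $$ (fst z i, snd z j)) \<in> measurable M (count_space UNIV)"
      if "i \<in> {..<n}" "j \<in> {..<n}" for i j
      using that z less by (auto intro!: entry)
    have "F z = {\<omega> \<in> space M. \<forall>i\<in>{..<n}. \<forall>j\<in>{..<n}. A \<omega> $$ (fst z i, snd z j) = A \<omega> $$ (i, j)}"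
      by (auto simp: F_def automorphism_def dims)
    also have "\<dots> \<in> events" by measurable
    finally show ?thesis .
  qed
  have F_prob: "prob (F (\<alpha>, \<beta>)) \<le> x ^ ?m \<alpha> * x ^ ?m \<beta>"
    if \<alpha>: "\<alpha> permutes {..<n}" and \<beta>: "\<beta> permutes {..<n}" for \<alpha> \<beta>
  proof -
    (* Outside the square, map_prod \<alpha> \<beta> need not be the identity: it moves (i, j) for i \<ge> n
       and j moved by \<beta>. It is therefore cut off to obtain a permutation of the cells. *)
    define \<pi> where "\<pi> c = (if c \<in> ?I then map_prod \<alpha> \<beta> c else c)" for c
    have \<pi>: "\<pi> permutes ?I"
    proof (rule bij_imp_permutes)
      have "bij_betw (map_prod \<alpha> \<beta>) ?I ?I"
        using permutes_imp_bij[OF \<alpha>] permutes_imp_bij[OF \<beta>] by (rule bij_betw_map_prod)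
      then show "bij_betw \<pi> ?I ?I" by (rule bij_betw_cong[THEN iffD1, rotated]) (simp add: \<pi>_def)
    qed (simp only: \<pi>_def if_False)
    have "F (\<alpha>, \<beta>) = {\<omega> \<in> space M. \<forall>c\<in>?I. ?X (\<pi> c) \<omega> = ?X c \<omega>}"
      by (auto simp: F_def automorphism_def dims \<pi>_def)
    then have "prob (F (\<alpha>, \<beta>)) \<le> exp (- (p * (1 - p))) ^ card {c \<in> ?I. \<pi> c \<noteq> c}"
      using prob_invariant_le[OF indep _ p01 _ \<pi>] dist by auto
    also have "{c \<in> ?I. \<pi> c \<noteq> c} = {c \<in> ?I. map_prod \<alpha> \<beta> c \<noteq> c}" by (auto simp: \<pi>_def)
    also have "exp (- (p * (1 - p))) ^ card \<dots> = exp (- (p * (1 - p) * card \<dots>))"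
      by (simp add: exp_of_nat_mult[symmetric] mult.commute)
    also have "\<dots> \<le> exp (- (p * (1 - p) * (n * (?m \<alpha> + ?m \<beta>) / 2)))"
    proof -
      have "real (n * (?m \<alpha> + ?m \<beta>)) \<le> real (2 * card {c \<in> ?I. map_prod \<alpha> \<beta> c \<noteq> c})"
        using moved_cells_ge unfolding of_nat_le_iff .
      then have "n * (?m \<alpha> + ?m \<beta>) / 2 \<le> real (card {c \<in> ?I. map_prod \<alpha> \<beta> c \<noteq> c})" by simp
      then have "p * (1 - p) * (n * (?m \<alpha> + ?m \<beta>) / 2)
          \<le> p * (1 - p) * card {c \<in> ?I. map_prod \<alpha> \<beta> c \<noteq> c}"
        using p01 by (intro mult_left_mono) auto
      then show ?thesis by (simp only: exp_le_cancel_iff neg_le_iff_le)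
    qed
    also have "\<dots> = x ^ (?m \<alpha> + ?m \<beta>)"
      by (simp add: x(1) exp_of_nat_mult[symmetric] field_simps)
    finally show ?thesis by (simp add: power_add)
  qed
  have finP: "finite ?P" by (simp add: finite_permutations)
  have bad: "space M - {\<omega> \<in> space M. reconstructible (A \<omega>)} = (\<Union>z\<in>?P \<times> ?P - {(id, id)}. F z)"
  proof -
    have "reconstructible (A \<omega>) \<longleftrightarrow> (\<forall>z\<in>?P \<times> ?P - {(id, id)}. \<not> automorphism (A \<omega>) (fst z) (snd z))"
      if "\<omega> \<in> space M" for \<omega>
      unfolding reconstructible_iff_no_automorphism[OF carrier[OF that]] Ball_def split_paired_All by auto
    then show ?thesis unfolding F_def by blast
  qed
  (* Reconstructibility is an event because failure is a finite union of events. *)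
  have good_event: "{\<omega> \<in> space M. reconstructible (A \<omega>)} \<in> events"
  proof -
    have "{\<omega> \<in> space M. reconstructible (A \<omega>)} = space M - (\<Union>z\<in>?P \<times> ?P - {(id, id)}. F z)"
      unfolding bad[symmetric] by auto
    also have "\<dots> \<in> events"
      using finP F_event by (intro sets.Diff sets.top sets.finite_UN) auto
    finally show ?thesis .
  qed
  have x0: "0 \<le> x" by (simp add: x(1))
  have s: "(\<Sum>\<alpha>\<in>?P. x ^ ?m \<alpha>) \<le> 1 / (1 - n * x)"
    using sum_permutations_power_moved_le[of "{..<n}" x] x0 x(2) by simp
  have "prob (\<Union>z\<in>?P \<times> ?P - {(id, id)}. F z) \<le> (\<Sum>z\<in>?P \<times> ?P - {(id, id)}. prob (F z))"
    using finP F_event by (intro finite_measure_subadditive_finite) auto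
  also have "\<dots> \<le> (\<Sum>z\<in>?P \<times> ?P - {(id, id)}. x ^ ?m (fst z) * x ^ ?m (snd z))"
    using F_prob by (intro sum_mono) auto
  also have "\<dots> = (\<Sum>z\<in>?P \<times> ?P. x ^ ?m (fst z) * x ^ ?m (snd z)) - 1"
    using finP permutes_id by (subst sum_diff1) auto
  also have "(\<Sum>z\<in>?P \<times> ?P. x ^ ?m (fst z) * x ^ ?m (snd z)) = (\<Sum>\<alpha>\<in>?P. x ^ ?m \<alpha>)\<^sup>2"
    by (simp add: power2_eq_square sum_product sum.cartesian_product case_prod_beta)
  also have "\<dots> \<le> (1 / (1 - n * x))\<^sup>2"
    using s x0 by (intro power_mono) (auto intro!: sum_nonneg)
  finally show ?thesis
    using prob_compl[OF good_event] unfolding bad by linarith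
qed

theorem theorem4:
  fixes \<Omega> :: "nat \<Rightarrow> 'a measure"
    and M :: "nat \<Rightarrow> 'a \<Rightarrow> bool mat"
    and p :: "nat \<Rightarrow> real"
    and \<epsilon> :: real
  assumes "\<And>n. prob_space (\<Omega> n)"
    and "\<And>n \<omega>. \<omega> \<in> space (\<Omega> n) \<Longrightarrow> M n \<omega> \<in> carrier_mat n n"
    and "\<And>n. prob_space.indep_vars (\<Omega> n) (\<lambda>_. count_space UNIV)
               (\<lambda>(i, j) \<omega>. M n \<omega> $$ (i, j)) ({..<n} \<times> {..<n})"
    and "\<And>n i j. i < n \<Longrightarrow> j < n \<Longrightarrow>
           measure (\<Omega> n) {\<omega> \<in> space (\<Omega> n). M n \<omega> $$ (i, j) = True} = p n"
    and "\<And>n i j. i < n \<Longrightarrow> j < n \<Longrightarrow>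
           measure (\<Omega> n) {\<omega> \<in> space (\<Omega> n). M n \<omega> $$ (i, j) = False} = 1 - p n"
    and "\<And>n. p n \<le> 1 / 2"
    and "\<epsilon> > 0"
    and "\<forall>\<^sub>F n in sequentially. p n \<ge> 2 * (1 + \<epsilon>) * ln (real n) / real n"
  shows "(\<lambda>n. measure (\<Omega> n) {\<omega> \<in> space (\<Omega> n). reconstructible (M n \<omega>)}) \<longlonglongrightarrow> 1"
proof -
  define x where "x n = exp (- (p n * (1 - p n) * n / 2))" for n :: nat
  define p0 where "p0 n = 2 * (1 + \<epsilon>) * ln (real n) / real n" for n :: nat
  define y where "y n = n * exp (- (p0 n * (1 - p0 n) * n / 2))" for n :: nat
  have y: "y \<longlonglongrightarrow> 0"
    unfolding y_def p0_def using \<open>\<epsilon> > 0\<close> by real_asymp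
  have "\<forall>\<^sub>F n in sequentially. n * x n \<le> y n"
    using assms(8) eventually_ge_at_top[of 1]
  proof eventually_elim
    case (elim n)
    (* p (1 - p) is increasing on [0, 1/2], so it is smallest at the threshold p0. *)
    have "0 \<le> (p n - p0 n) * (1 - p n - p0 n)"
      using elim assms(6)[of n] by (intro mult_nonneg_nonneg) (simp_all add: p0_def)
    then have "p0 n * (1 - p0 n) \<le> p n * (1 - p n)" by (simp add: algebra_simps)
    then have "x n \<le> exp (- (p0 n * (1 - p0 n) * n / 2))"
      unfolding x_def by (auto intro!: divide_right_mono mult_right_mono)
    then show ?case unfolding y_def by (intro mult_left_mono) auto
  qed
  then have nx: "(\<lambda>n. n * x n) \<longlonglongrightarrow> 0"
    using tendsto_const y by (rule tendsto_sandwich[rotated]) (simp add: x_def)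
  have "\<forall>\<^sub>F n in sequentially. n * x n < 1" using nx by (rule order_tendstoD) simp
  then have lower: "\<forall>\<^sub>F n in sequentially. 2 - (1 / (1 - n * x n))\<^sup>2
      \<le> measure (\<Omega> n) {\<omega> \<in> space (\<Omega> n). reconstructible (M n \<omega>)}"
    using eventually_ge_at_top[of 1]
  proof eventually_elim
    case (elim n)
    interpret prob_space "\<Omega> n" by (rule assms(1))
    have p01: "0 \<le> p n" "p n \<le> 1"
      using assms(4)[of 0 n 0] elim(2) assms(6)[of n] by (auto simp flip: assms(4)[of 0 n 0])
    show ?case
      using assms(4,5) elim(1)
      by (intro random_matrix_reconstructible_ge[OF assms(2) assms(3) p01 _ x_def]) auto
  qed
  have "(\<lambda>n. 2 - (1 / (1 - n * x n))\<^sup>2) \<longlonglongrightarrow> 2 - (1 / (1 - 0))\<^sup>2"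
    by (intro tendsto_intros nx) simp
  then have "(\<lambda>n. 2 - (1 / (1 - n * x n))\<^sup>2) \<longlonglongrightarrow> 1" by simp
  moreover have "measure (\<Omega> n) {\<omega> \<in> space (\<Omega> n). reconstructible (M n \<omega>)} \<le> 1" for n
    using prob_space.prob_le_1[OF assms(1)] .
  ultimately show ?thesis
    using lower by (intro tendsto_sandwich[OF lower _ _ tendsto_const]) auto
qed

end
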